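(* Let $m, n$ be fixed coprime natural numbers, and say that a group $G$ has property $\mathcal{P}$ if $a^i b^i = b^i a^i$ for $i = m, n$ and for all $a, b \in G$. Let $\mathcal{X}$ be a class of groups. Suppose that every group in $\mathcal{X}$ satisfying $\mathcal{P}$ is abelian. Then the following statements hold. (a) Every locally $\mathcal{X}$ group satisfying $\mathcal{P}$ is abelian. (b) Every residually $\mathcal{X}$ group satisfying $\mathcal{P}$ is abelian.
   Context: Natural numbers are positive integers. The pair $m, n$ is fixed throughout, and property $\mathcal{P}$ refers to this fixed pair. For a class $\mathcal{X}$ of groups, a group $G$ is locally $\mathcal{X}$ if every finitely generated subgroup of $G$ is in $\mathcal{X}$; a group $G$ is residually $\mathcal{X}$ if for each non-identity element $g \in G$ there is a normal subgroup $N_g$ of $G$ such that $g \notin N_g$ and $G/N_g \in \mathcal{X}$. *)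

theory Defs
  imports "HOL-Algebra.Generated_Groups" "HOL-Algebra.Coset"
begin

definition property_P :: "nat \<Rightarrow> nat \<Rightarrow> ('a, 'c) monoid_scheme \<Rightarrow> bool" where
  "property_P m n G \<longleftrightarrow>
     (\<forall>i\<in>{m, n}. \<forall>a\<in>carrier G. \<forall>b\<in>carrier G.
        (a [^]\<^bsub>G\<^esub> i) \<otimes>\<^bsub>G\<^esub> (b [^]\<^bsub>G\<^esub> i) = (b [^]\<^bsub>G\<^esub> i) \<otimes>\<^bsub>G\<^esub> (a [^]\<^bsub>G\<^esub> i))"

text \<open>
  A class of groups is given by a set of groups over some type \<open>'u\<close>.  As usual, membership
  in a class is understood up to isomorphism.  This makes membership meaningful for groups
  over any type, which is needed because the elements of a quotient of a group over \<open>'a\<close>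
  are cosets, of type \<open>'a set\<close>.  The type \<open>'u\<close> only bounds the size of the members of
  the class; it is independent of \<open>'a\<close> and can be chosen as large as desired.
\<close>

definition in_class :: "('a, 'c) monoid_scheme \<Rightarrow> 'u monoid set \<Rightarrow> bool" where
  "in_class G X \<longleftrightarrow> group G \<and> (\<exists>H\<in>X. G \<cong> H)"

definition finitely_generated_subgroup :: "'a set \<Rightarrow> ('a, 'c) monoid_scheme \<Rightarrow> bool" where
  "finitely_generated_subgroup H G \<longleftrightarrow>
     subgroup H G \<and> (\<exists>S. finite S \<and> S \<subseteq> carrier G \<and> H = generate G S)"

definition locally_in_class :: "('a, 'c) monoid_scheme \<Rightarrow> 'u monoid set \<Rightarrow> bool" where
  "locally_in_class G X \<longleftrightarrow>
     group G \<and> (\<forall>H. finitely_generated_subgroup H G \<longrightarrow> in_class (G\<lparr>carrier := H\<rparr>) X)"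

definition residually_in_class :: "('a, 'c) monoid_scheme \<Rightarrow> 'u monoid set \<Rightarrow> bool" where
  "residually_in_class G X \<longleftrightarrow>
     group G \<and> (\<forall>g\<in>carrier G. g \<noteq> \<one>\<^bsub>G\<^esub> \<longrightarrow> (\<exists>N. N \<lhd> G \<and> g \<notin> N \<and> in_class (G Mod N) X))"

end

theory Submission
  imports Defs
begin

text \<open>Hence every finitely generated subgroup in (a), and every quotient
  \<open>G Mod N\<close> provided by residuality in (b), is a group with P isomorphic to a member of
  \<open>X\<close>, and so is abelian (\<open>in_class_comm_group\<close>). It remains to see that
  commutativity is inherited from these pieces: a pair of elements lies in a finitely generated
  subgroup (\<open>locally_comm_group\<close>), and a nontrivial commutator would survive in one of
  the quotients (\<open>residually_comm_group\<close>).\<close>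

text \<open>Laws descend along surjections: lift both elements to \<open>G\<close> and apply
  \<open>h\<close> to the law there. This serves both for quotient maps and for transport along
  isomorphisms.\<close>

lemma property_P_surj_hom:
  assumes "group G" "group K" "h \<in> hom G K" "h ` carrier G = carrier K" "property_P m n G"
  shows "property_P m n K"
  unfolding property_P_def
proof (intro ballI)
  interpret group_hom G K h
    using assms by (simp add: group_hom_def group_hom_axioms_def)
  fix i x y assume i: "i \<in> {m, n}" and "x \<in> carrier K" "y \<in> carrier K"
  then obtain a b where ab: "a \<in> carrier G" "b \<in> carrier G" and "x = h a" "y = h b"
    using assms(4) by (metis imageE)
  moreover have "h (a [^]\<^bsub>G\<^esub> i \<otimes>\<^bsub>G\<^esub> b [^]\<^bsub>G\<^esub> i) = h (b [^]\<^bsub>G\<^esub> i \<otimes>\<^bsub>G\<^esub> a [^]\<^bsub>G\<^esub> i)"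
    using assms(5) i ab unfolding property_P_def by (intro arg_cong[of _ _ h]) blast
  ultimately show "x [^]\<^bsub>K\<^esub> i \<otimes>\<^bsub>K\<^esub> y [^]\<^bsub>K\<^esub> i = y [^]\<^bsub>K\<^esub> i \<otimes>\<^bsub>K\<^esub> x [^]\<^bsub>K\<^esub> i"
    by (simp add: hom_nat_pow)
qed

lemma property_P_subgroup:
  assumes "group G" "subgroup H G" "property_P m n G"
  shows "property_P m n (G\<lparr>carrier := H\<rparr>)"
  using assms(3) subgroup.mem_carrier[OF assms(2)]
  by (simp add: property_P_def monoid.nat_pow_consistent[OF group.is_monoid[OF assms(1)], symmetric])

text \<open>The hypothesis on \<open>X\<close> speaks only of its actual members, whereas
  \<open>in_class\<close> is membership up to isomorphism. So P is pushed forward along an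
  isomorphism to a member, and commutativity is pulled back by injectivity.\<close>

lemma in_class_comm_group:
  fixes X :: "'u monoid set"
  assumes "\<And>H. H \<in> X \<Longrightarrow> group H"
    and "\<And>H. H \<in> X \<Longrightarrow> property_P m n H \<Longrightarrow> comm_group H"
    and "in_class K X" "property_P m n K"
  shows "comm_group K"
proof -
  from assms(3) obtain H h where K: "group K" and H: "H \<in> X" and h: "h \<in> iso K H"
    unfolding in_class_def is_iso_def by blast
  have hom: "h \<in> hom K H" and surj: "h ` carrier K = carrier H" and inj: "inj_on h (carrier K)"
    using h by (auto simp: iso_def bij_betw_def)
  interpret K: group K by (fact K)
  interpret H: comm_group H
    using assms(2)[OF H property_P_surj_hom[OF K assms(1)[OF H] hom surj assms(4)]] .
  show ?thesis
  proof (rule K.group_comm_groupI)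
    fix x y assume xy: "x \<in> carrier K" "y \<in> carrier K"
    then have "h (x \<otimes>\<^bsub>K\<^esub> y) = h (y \<otimes>\<^bsub>K\<^esub> x)"
      using hom by (simp add: hom_mult hom_in_carrier H.m_comm)
    then show "x \<otimes>\<^bsub>K\<^esub> y = y \<otimes>\<^bsub>K\<^esub> x"
      using inj xy by (simp add: inj_on_eq_iff)
  qed
qed

text \<open>Commutativity involves two elements at a time, so it can be tested in the subgroup that
  they generate.\<close>

lemma locally_comm_group:
  assumes G: "group G"
    and fg: "\<And>H. finitely_generated_subgroup H G \<Longrightarrow> comm_group (G\<lparr>carrier := H\<rparr>)"
  shows "comm_group G"
proof (rule group.group_comm_groupI[OF G])
  interpret group G by (fact G)
  fix a b assume ab: "a \<in> carrier G" "b \<in> carrier G"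
  let ?H = "generate G {a, b}"
  have "finitely_generated_subgroup ?H G"
    unfolding finitely_generated_subgroup_def
    using ab by (intro conjI generate_is_subgroup exI[of _ "{a, b}"]) auto
  then interpret H: comm_group "G\<lparr>carrier := ?H\<rparr>" by (rule fg)
  show "a \<otimes>\<^bsub>G\<^esub> b = b \<otimes>\<^bsub>G\<^esub> a"
    using H.m_comm[of a b] by (simp add: generate.incl)
qed

lemma residually_comm_group:
  assumes G: "group G"
    and res: "\<And>g. g \<in> carrier G \<Longrightarrow> g \<noteq> \<one>\<^bsub>G\<^esub> \<Longrightarrow>
      \<exists>N. N \<lhd> G \<and> g \<notin> N \<and> comm_group (G Mod N)"
  shows "comm_group G"
proof (rule group.group_comm_groupI[OF G], rule ccontr)
  interpret group G by (fact G)
  fix a b assume ab: "a \<in> carrier G" "b \<in> carrier G"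
    and ne: "a \<otimes>\<^bsub>G\<^esub> b \<noteq> b \<otimes>\<^bsub>G\<^esub> a"
  \<comment> \<open>The commutator of \<open>a\<close> and \<open>b\<close>, written as a quotient
    of the two products: it lies in \<open>N\<close> exactly when these products have the same right
    coset.\<close>
  let ?g = "(a \<otimes>\<^bsub>G\<^esub> b) \<otimes>\<^bsub>G\<^esub> inv\<^bsub>G\<^esub> (b \<otimes>\<^bsub>G\<^esub> a)"
  have "?g \<noteq> \<one>\<^bsub>G\<^esub>"
    using ab ne by (metis inv_equality inv_inv inv_closed m_closed)
  then obtain N where N: "N \<lhd> G" and g: "?g \<notin> N" and comm: "comm_group (G Mod N)"
    using res[of ?g] ab by auto
  interpret N: normal N G by (fact N)
  interpret Q: comm_group "G Mod N" by (fact comm)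
  \<comment> \<open>The cosets of \<open>a\<close> and \<open>b\<close> multiply to the coset of the
    product, so this is commutativity of \<open>G Mod N\<close>.\<close>
  have "N #>\<^bsub>G\<^esub> (a \<otimes>\<^bsub>G\<^esub> b) = N #>\<^bsub>G\<^esub> (b \<otimes>\<^bsub>G\<^esub> a)"
    using Q.m_comm[of "N #>\<^bsub>G\<^esub> a" "N #>\<^bsub>G\<^esub> b"] ab
    by (simp add: FactGroup_def N.rcos_sum rcosetsI N.subset)
  then have "a \<otimes>\<^bsub>G\<^esub> b \<in> N #>\<^bsub>G\<^esub> (b \<otimes>\<^bsub>G\<^esub> a)"
    using ab by (metis N.subgroup_axioms m_closed rcos_self)
  then have "?g \<in> N"
    using ab by (simp add: N.rcos_module_imp)
  with g show False ..
qed

theorem theorem2p1: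
  fixes m n :: nat and X :: "'u monoid set"
  assumes "m > 0" and "n > 0" and "coprime m n"
    and "\<And>H. H \<in> X \<Longrightarrow> group H"
    and "\<And>H. H \<in> X \<Longrightarrow> property_P m n H \<Longrightarrow> comm_group H"
  shows "(\<forall>G :: 'a monoid. locally_in_class G X \<longrightarrow> property_P m n G \<longrightarrow> comm_group G) \<and>
         (\<forall>G :: 'a monoid. residually_in_class G X \<longrightarrow> property_P m n G \<longrightarrow> comm_group G)"
proof (intro conjI allI impI)
  fix G :: "'a monoid"
  assume loc: "locally_in_class G X" and P: "property_P m n G"
  then have G: "group G" by (simp add: locally_in_class_def)
  show "comm_group G"
  proof (rule locally_comm_group[OF G])
    fix H assume H: "finitely_generated_subgroup H G"
    then have "subgroup H G" by (simp add: finitely_generated_subgroup_def)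
    then have "property_P m n (G\<lparr>carrier := H\<rparr>)" by (rule property_P_subgroup[OF G _ P])
    moreover have "in_class (G\<lparr>carrier := H\<rparr>) X"
      using loc H by (simp add: locally_in_class_def)
    ultimately show "comm_group (G\<lparr>carrier := H\<rparr>)"
      using in_class_comm_group[OF assms(4,5)] by blast
  qed
next
  fix G :: "'a monoid"
  assume res: "residually_in_class G X" and P: "property_P m n G"
  then have G: "group G" by (simp add: residually_in_class_def)
  show "comm_group G"
  proof (rule residually_comm_group[OF G])
    fix g assume "g \<in> carrier G" "g \<noteq> \<one>\<^bsub>G\<^esub>"
    then obtain N where N: "N \<lhd> G" "g \<notin> N" "in_class (G Mod N) X"
      using res unfolding residually_in_class_def by blast
    \<comment> \<open>The canonical projection is onto, so the quotient inherits P from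
      \<open>G\<close>.\<close>
    have "(\<lambda>a. N #>\<^bsub>G\<^esub> a) ` carrier G = carrier (G Mod N)"
      by (auto simp: FactGroup_def RCOSETS_def)
    then have "property_P m n (G Mod N)"
      by (rule property_P_surj_hom[OF G normal.factorgroup_is_group normal.r_coset_hom_Mod _ P, OF N(1) N(1)])
    then have "comm_group (G Mod N)"
      using in_class_comm_group[OF assms(4,5)] N(3) by blast
    with N show "\<exists>N. N \<lhd> G \<and> g \<notin> N \<and> comm_group (G Mod N)" by blast
  qed
qed

end
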